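(* Let $\alpha \in (0,1)$ and $\beta > \alpha$. Suppose that there exist $C < \infty$, $c>0$, and $x_0 < \infty$ for which, for all $t \in \mathbb{Z}^+$, $$\mathbb{E} [ (\Delta_t^-)^\beta \mid \mathcal{F}_t ] \leq C \quad \text{a.s.},$$ and, for all $x \geq x_0$ and all $t \in \mathbb{Z}^+$, $$\mathbb{E} [ \Delta_t^+ \mathbf{1} \{ \Delta_t^+ \leq x \} \mid \mathcal{F}_t ] \geq c x^{1-\alpha} \quad \text{a.s.}$$ Then $X_t \to + \infty$ a.s. as $t \to \infty$.
   Context: $\mathbb{Z}^+ = \{0,1,2,\ldots\}$. $(X_t)_{t \in \mathbb{Z}^+}$ is a real-valued stochastic process adapted to a filtration $(\mathcal{F}_t)_{t \in \mathbb{Z}^+}$, with $X_0 = 0$ (no Markov property is assumed). Its increments are $\Delta_t := X_{t+1} - X_t$. For real $x$, $x^+ := x \mathbf{1}\{x>0\}$ and $x^- := -x\mathbf{1}\{x<0\}$, so $x = x^+ - x^-$; $\Delta_t^\pm := (\Delta_t)^\pm$. The constants $c, C, x_0$ are non-random and do not depend on $t$; $x_0$ is understood to be positive so that powers of $x \geq x_0$ are defined. *)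

theory Defs
  imports "HOL-Probability.Probability"
begin

definition pos_part :: "real \<Rightarrow> real" where
  "pos_part x = x * indicator {y. y > 0} x"

definition neg_part :: "real \<Rightarrow> real" where
  "neg_part x = - x * indicator {y. y < 0} x"

definition increment :: "(nat \<Rightarrow> 'a \<Rightarrow> real) \<Rightarrow> nat \<Rightarrow> 'a \<Rightarrow> real" where
  "increment X t \<omega> = X (Suc t) \<omega> - X t \<omega>"

text \<open>
  The library locale \<^locale>\<open>filtration\<close> only fixes the common underlying space and
  monotonicity; that the sigma-algebras consist of events of \<open>M\<close> is stated separately.
\<close>

definition adapted_process ::
  "'a measure \<Rightarrow> (nat \<Rightarrow> 'a measure) \<Rightarrow> (nat \<Rightarrow> 'a \<Rightarrow> real) \<Rightarrow> bool" where
  "adapted_process M F X \<longleftrightarrow>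
     filtration (space M) F \<and>
     (\<forall>t. subalgebra M (F t)) \<and>
     (\<forall>t. X t \<in> borel_measurable (F t))"

text \<open>
  Conditional expectations of nonnegative variables are taken with \<^const>\<open>nn_cond_exp\<close>
  (values in \<^typ>\<open>ennreal\<close>). With \<^const>\<open>real_cond_exp\<close> an infinite conditional
  expectation would be read as 0, and an upper bound on it would not be a moment condition.
\<close>

end

theory Submission
  imports Defs "HOL-Real_Asymp.Real_Asymp"
begin

text \<open>
  Let \<open>P\<^sub>t\<close> and \<open>N\<^sub>t\<close> be the sums of the positive and of the negative parts of the first \<open>t\<close>
  increments, so that \<open>X\<^sub>t = P\<^sub>t - N\<^sub>t\<close>. The two moment conditions say that upward jumps are
  heavier than downward ones: \<open>P\<^sub>t\<close> should grow at least like \<open>t powr (1/\<alpha>)\<close> and \<open>N\<^sub>t\<close> at most like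
  \<open>t powr (1/b)\<close>, where \<open>b = min \<beta> 1 > \<alpha>\<close>. Fix \<open>q\<close> strictly between \<open>1/b\<close> and \<open>1/\<alpha>\<close>. It then
  suffices that, almost surely, \<open>N\<^sub>t / t powr q\<close> stays bounded and \<open>P\<^sub>t / t powr q\<close> tends to
  infinity. Both statements rest on the fact that a series of nonnegative variables with
  summable expectations converges almost surely.

  For \<open>N\<close>, the \<open>b\<close>-th moments of the single terms are bounded and \<open>q * b > 1\<close>, so the \<open>b\<close>-th powers of
  the negative parts, weighted by \<open>(s+1) powr (- q * b)\<close>, have an almost surely finite sum. Since \<open>b \<le> 1\<close>,
  the map \<open>u \<mapsto> u powr b\<close> is subadditive, which turns this into \<open>N\<^sub>t \<le> W * t powr q\<close> with a
  random constant \<open>W\<close> (\<open>sum_le_powr_if_summable_weighted_powr\<close>).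

  For \<open>P\<close>, conditioning step by step on the past gives
  \<open>E exp (- P\<^sub>t / x) \<le> exp (- c * t * x powr (- \<alpha>) / 2)\<close> for every level \<open>x \<ge> x\<^sub>0\<close>
  (\<open>nn_integral_exp_minus_sum_le\<close>). At \<open>x = t powr q\<close> the exponent is of order
  \<open>t powr (1 - q * \<alpha>)\<close>, a positive power of \<open>t\<close>, so these expectations are summable. Hence
  \<open>exp (- P\<^sub>t / t powr q)\<close> tends to 0 almost surely.
\<close>

section \<open>Elementary inequalities\<close>

lemma powr_add_le_add_powr:
  fixes x y b :: real
  assumes "0 \<le> x" "0 \<le> y" "0 < b" "b \<le> 1"
  shows "(x + y) powr b \<le> x powr b + y powr b"
proof (cases "x + y = 0")
  case True
  then show ?thesis using assms by simp
next
  case False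
  then have s: "x + y > 0" using assms by linarith
  \<comment> \<open>On the unit interval \<open>u \<le> u powr b\<close>; apply this to the two shares of the sum.\<close>
  have share: "u / (x + y) \<le> u powr b / (x + y) powr b" if "0 \<le> u" "u \<le> x + y" for u
  proof -
    have "u / (x + y) = (u / (x + y)) powr 1" using that s by simp
    also have "\<dots> \<le> (u / (x + y)) powr b"
      using that s assms by (intro powr_mono') (auto simp: divide_simps)
    also have "\<dots> = u powr b / (x + y) powr b" using that s by (simp add: powr_divide)
    finally show ?thesis .
  qed
  have "1 = x / (x + y) + y / (x + y)" using False by (subst add_divide_distrib[symmetric]) simp
  also have "\<dots> \<le> x powr b / (x + y) powr b + y powr b / (x + y) powr b"
    using assms by (intro add_mono share) auto
  finally show ?thesis using s by (simp add: field_simps)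
qed

lemma powr_sum_le_sum_powr:
  fixes a :: "'i \<Rightarrow> real"
  assumes "finite A" "\<And>i. i \<in> A \<Longrightarrow> 0 \<le> a i" "0 < b" "b \<le> 1"
  shows "(\<Sum>i\<in>A. a i) powr b \<le> (\<Sum>i\<in>A. a i powr b)"
  using assms(1,2)
proof (induction A rule: finite_induct)
  case (insert i A)
  have "(a i + (\<Sum>j\<in>A. a j)) powr b \<le> a i powr b + (\<Sum>j\<in>A. a j) powr b"
    using insert.prems assms(3,4) by (intro powr_add_le_add_powr sum_nonneg) auto
  also have "\<dots> \<le> a i powr b + (\<Sum>j\<in>A. a j powr b)"
    using insert by auto
  finally show ?case using insert by simp
qed simp

lemma exp_minus_le_linear:
  fixes u :: real
  assumes "0 \<le> u" "u \<le> 1"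
  shows "exp (- u) \<le> 1 - u / 2"
proof -
  have "u * u \<le> u" using assms by (simp add: mult_left_le)
  then have "1 \<le> (1 - u / 2) * (1 + u)" by (simp add: algebra_simps)
  also have "\<dots> \<le> (1 - u / 2) * exp u"
    using assms exp_ge_add_one_self[of u] by (intro mult_left_mono) auto
  finally show ?thesis by (simp add: exp_minus field_simps)
qed

lemma powr_le_one_plus_powr:
  fixes d b e :: real
  assumes "0 \<le> d" "0 < b" "b \<le> e"
  shows "d powr b \<le> 1 + d powr e"
proof (cases "d \<le> 1")
  case True
  then have "d powr b \<le> 1" using assms by (intro powr_le1) auto
  then show ?thesis using powr_ge_zero[of d e] by linarith
next
  case False
  then have "d powr b \<le> d powr e" using assms by (intro powr_mono) auto
  then show ?thesis by linarith
qed

section \<open>Pathwise comparison of the two partial sums\<close>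

text \<open>
  A weighted sum of \<open>b\<close>-th powers controls all partial sums at once: for \<open>s < t\<close> the weight is at
  least \<open>t powr (- q * b)\<close>, so the \<open>b\<close>-th powers of the first \<open>t\<close> terms sum to at most a
  constant times \<open>t powr (q * b)\<close>; subadditivity of \<open>powr b\<close> and a \<open>b\<close>-th root give the claim.
\<close>

lemma sum_le_powr_if_summable_weighted_powr:
  fixes n :: "nat \<Rightarrow> real"
  assumes "\<And>s. 0 \<le> n s" "0 < b" "b \<le> 1" "0 < q"
    and summ: "summable (\<lambda>s. n s powr b / real (Suc s) powr (q * b))"
  shows "\<exists>W. \<forall>t. (\<Sum>s<t. n s) \<le> W * real t powr q"
proof -
  define w where "w = (\<lambda>s. n s powr b / real (Suc s) powr (q * b))"
  have w0: "0 \<le> w s" for s by (simp add: w_def)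
  have "(\<Sum>s<t. n s) \<le> suminf w powr (1 / b) * real t powr q" for t
  proof -
    let ?N = "\<Sum>s<t. n s"
    have N0: "0 \<le> ?N" by (intro sum_nonneg assms)
    have "?N powr b \<le> (\<Sum>s<t. n s powr b)"
      using assms by (intro powr_sum_le_sum_powr) auto
    also have "\<dots> \<le> (\<Sum>s<t. real t powr (q * b) * w s)"
    proof (rule sum_mono)
      fix s assume s: "s \<in> {..<t}"
      have "n s powr b = real (Suc s) powr (q * b) * w s" by (simp add: w_def)
      also have "\<dots> \<le> real t powr (q * b) * w s"
        using s assms w0 by (intro mult_right_mono powr_mono2) auto
      finally show "n s powr b \<le> real t powr (q * b) * w s" .
    qed
    also have "\<dots> = real t powr (q * b) * (\<Sum>s<t. w s)" by (simp add: sum_distrib_left)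
    also have "\<dots> \<le> real t powr (q * b) * suminf w"
      using summ w0 by (intro mult_left_mono sum_le_suminf) (auto simp: w_def)
    finally have le: "?N powr b \<le> real t powr (q * b) * suminf w" .
    have W0: "0 \<le> suminf w" using summ w0 by (intro suminf_nonneg) (auto simp: w_def)
    have "?N = (?N powr b) powr (1 / b)" using N0 assms by (simp add: powr_powr)
    also have "\<dots> \<le> (real t powr (q * b) * suminf w) powr (1 / b)"
      using le assms by (intro powr_mono2) auto
    also have "\<dots> = suminf w powr (1 / b) * real t powr q"
      using W0 assms by (simp add: powr_mult powr_powr)
    finally show ?thesis .
  qed
  then show ?thesis by blast
qed

text \<open>
  The exponentials tend to 0, so the ratio of the first sum to \<open>t powr q\<close> eventually exceeds
  \<open>W + 1\<close>, and the difference of the sums exceeds \<open>t powr q\<close>. The shift \<open>k\<close> leaves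
  room for bounds that hold only from some time on.
\<close>

lemma difference_of_sums_tendsto_infinity:
  fixes p n :: "nat \<Rightarrow> real"
  assumes "0 < q"
    and W: "\<And>t. (\<Sum>s<t. n s) \<le> W * real t powr q"
    and summ: "summable (\<lambda>t. exp (- ((\<Sum>s<t + k. p s) / real (t + k) powr q)))"
  shows "filterlim (\<lambda>t. (\<Sum>s<t. p s) - (\<Sum>s<t. n s)) at_top sequentially"
proof -
  define r where "r = (\<lambda>t. (\<Sum>s<t. p s) / real t powr q)"
  have "(\<lambda>t. exp (- r (t + k))) \<longlonglongrightarrow> 0"
    using summable_LIMSEQ_zero[OF summ] by (simp add: r_def)
  then have lim: "(\<lambda>t. exp (- r t)) \<longlonglongrightarrow> 0" by (rule LIMSEQ_offset)
  have ev: "eventually (\<lambda>t. exp (- r t) < exp (- (W + 1))) sequentially"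
    by (rule order_tendstoD(2)[OF lim]) (rule exp_gt_zero)
  have "eventually (\<lambda>t. real t powr q \<le> (\<Sum>s<t. p s) - (\<Sum>s<t. n s)) sequentially"
    using ev eventually_gt_at_top[of 0]
  proof eventually_elim
    case (elim t)
    then have t: "0 < real t powr q" and "W + 1 \<le> r t" by auto
    then have "(W + 1) * real t powr q \<le> (\<Sum>s<t. p s)"
      by (simp add: r_def field_simps)
    then show ?case using W[of t] by (simp add: algebra_simps)
  qed
  moreover have "filterlim (\<lambda>t. real t powr q) at_top sequentially"
    using \<open>0 < q\<close> by real_asymp
  ultimately show ?thesis by (rule filterlim_at_top_mono[rotated])
qed

section \<open>Summability from moment bounds\<close>

lemma AE_summable_of_nn_integral_le_summable:
  fixes f :: "nat \<Rightarrow> 'a \<Rightarrow> real"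
  assumes [measurable]: "\<And>t. f t \<in> borel_measurable M"
    and "\<And>t \<omega>. 0 \<le> f t \<omega>"
    and bound: "\<And>t. (\<integral>\<^sup>+ \<omega>. ennreal (f t \<omega>) \<partial>M) \<le> ennreal (g t)"
    and "summable g" "\<And>t. 0 \<le> g t"
  shows "AE \<omega> in M. summable (\<lambda>t. f t \<omega>)"
proof -
  have "(\<integral>\<^sup>+ \<omega>. (\<Sum>t. ennreal (f t \<omega>)) \<partial>M) = (\<Sum>t. \<integral>\<^sup>+ \<omega>. ennreal (f t \<omega>) \<partial>M)"
    by (rule nn_integral_suminf) simp
  also have "\<dots> \<le> (\<Sum>t. ennreal (g t))" by (intro suminf_le bound) auto
  also have "\<dots> < top" using ennreal_suminf_neq_top[OF assms(4,5)] by (simp only: less_top)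
  finally have "AE \<omega> in M. (\<Sum>t. ennreal (f t \<omega>)) \<noteq> \<infinity>"
    by (intro nn_integral_PInf_AE) auto
  then show ?thesis
    by eventually_elim (rule summable_suminf_not_top[OF assms(2)], simp only: infinity_ennreal_def not_False_eq_True)
qed

lemma summable_exp_minus_powr:
  fixes k h :: real
  assumes "0 < k" "0 < h"
  shows "summable (\<lambda>t. exp (- (k * real t powr h)))"
proof (rule summable_comparison_test_ev)
  show "eventually (\<lambda>t. norm (exp (- (k * real t powr h))) \<le> real t powr (-2)) sequentially"
    unfolding real_norm_def abs_exp_cancel using assms by real_asymp
  show "summable (\<lambda>t. real t powr (-2))" by (simp add: summable_real_powr_iff)
qed

section \<open>Lower tail of a sum with truncated conditional means bounded below\<close>

text \<open>
  \<open>G\<close> collects the factors already known at the present time. Truncating \<open>d\<close> at \<open>x\<close> keeps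
  \<open>d / x\<close> in the unit interval, where \<open>exp (- u) \<le> 1 - u / 2\<close>; the truncated mean then
  enters linearly, and conditioning replaces it by its lower bound \<open>m\<close>. The cost is the factor
  \<open>1 - m / (2 * x) \<le> exp (- m / (2 * x))\<close>. A jump larger than \<open>x\<close> only makes the
  left-hand side smaller.
\<close>

lemma nn_integral_exp_minus_step:
  fixes G :: "'a \<Rightarrow> real" and d :: "'a \<Rightarrow> real"
  assumes "prob_space M" and sub: "subalgebra M F"
    and G: "G \<in> borel_measurable F" "\<And>\<omega>. 0 \<le> G \<omega>" "\<And>\<omega>. G \<omega> \<le> 1"
    and d [measurable]: "d \<in> borel_measurable M" and d0: "\<And>\<omega>. 0 \<le> d \<omega>"
    and "0 < x" "0 \<le> m"
    and low: "AE \<omega> in M. nn_cond_exp M F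
        (\<lambda>\<omega>. ennreal (d \<omega> * indicator {\<omega>. d \<omega> \<le> x} \<omega>)) \<omega> \<ge> ennreal m"
  shows "(\<integral>\<^sup>+ \<omega>. ennreal (G \<omega> * exp (- d \<omega> / x)) \<partial>M)
      \<le> ennreal (exp (- (m / (2 * x)))) * (\<integral>\<^sup>+ \<omega>. ennreal (G \<omega>) \<partial>M)"
proof -
  interpret prob_space M by fact
  interpret finite_measure_subalgebra M F by unfold_locales (rule sub)
  note [measurable] = G(1) and GM [measurable] = measurable_from_subalg[OF sub G(1)]
  define y where "y = (\<lambda>\<omega>. d \<omega> * indicator {\<omega>. d \<omega> \<le> x} \<omega>)"
  have y_if: "y = (\<lambda>\<omega>. if d \<omega> \<le> x then d \<omega> else 0)" by (auto simp: y_def)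
  have [measurable]: "y \<in> borel_measurable M" unfolding y_if by measurable
  have y0: "0 \<le> y \<omega>" for \<omega> using d0 by (simp add: y_if)
  let ?a = "\<integral>\<^sup>+ \<omega>. ennreal (G \<omega> * exp (- d \<omega> / x)) \<partial>M"
  let ?b = "\<integral>\<^sup>+ \<omega>. ennreal (G \<omega>) \<partial>M"
  have "?b \<le> (\<integral>\<^sup>+ \<omega>. 1 \<partial>M)" using G by (intro nn_integral_mono) auto
  then have b1: "?b \<le> 1" by (simp add: emeasure_space_1)
  have pt: "G \<omega> * exp (- d \<omega> / x) + 1 / (2 * x) * (G \<omega> * y \<omega>) \<le> G \<omega>" for \<omega>
  proof -
    have "exp (- d \<omega> / x) \<le> 1 - y \<omega> / x / 2"
      using exp_minus_le_linear[of "d \<omega> / x"] d0[of \<omega>] \<open>0 < x\<close> by (auto simp: y_if)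
    then have "G \<omega> * exp (- d \<omega> / x) \<le> G \<omega> * (1 - y \<omega> / x / 2)"
      using G by (intro mult_left_mono) auto
    then show ?thesis by (simp add: algebra_simps)
  qed
  have "ennreal m * ?b = (\<integral>\<^sup>+ \<omega>. ennreal (G \<omega>) * ennreal m \<partial>M)"
    by (subst nn_integral_multc) (auto simp: mult.commute)
  also have "\<dots> \<le> (\<integral>\<^sup>+ \<omega>. ennreal (G \<omega>) * nn_cond_exp M F (\<lambda>\<omega>. ennreal (y \<omega>)) \<omega> \<partial>M)"
  proof (rule nn_integral_mono_AE)
    show "AE \<omega> in M. ennreal (G \<omega>) * ennreal m
        \<le> ennreal (G \<omega>) * nn_cond_exp M F (\<lambda>\<omega>. ennreal (y \<omega>)) \<omega>"
      using low unfolding y_def by eventually_elim (rule mult_left_mono, auto)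
  qed
  also have "\<dots> = (\<integral>\<^sup>+ \<omega>. ennreal (G \<omega>) * ennreal (y \<omega>) \<partial>M)"
    by (rule nn_cond_exp_intg) auto
  also have "\<dots> = (\<integral>\<^sup>+ \<omega>. ennreal (G \<omega> * y \<omega>) \<partial>M)"
    using G y0 by (simp add: ennreal_mult)
  finally have "ennreal (1 / (2 * x)) * (ennreal m * ?b)
      \<le> ennreal (1 / (2 * x)) * (\<integral>\<^sup>+ \<omega>. ennreal (G \<omega> * y \<omega>) \<partial>M)"
    by (rule mult_left_mono) simp
  then have "?a + ennreal (1 / (2 * x)) * (ennreal m * ?b)
      \<le> ?a + ennreal (1 / (2 * x)) * (\<integral>\<^sup>+ \<omega>. ennreal (G \<omega> * y \<omega>) \<partial>M)"
    by (rule add_left_mono)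
  also have "\<dots> = (\<integral>\<^sup>+ \<omega>. ennreal (G \<omega> * exp (- d \<omega> / x) + 1 / (2 * x) * (G \<omega> * y \<omega>)) \<partial>M)"
  proof -
    have "ennreal (G \<omega> * exp (- d \<omega> / x) + 1 / (2 * x) * (G \<omega> * y \<omega>))
        = ennreal (G \<omega> * exp (- d \<omega> / x)) + ennreal (1 / (2 * x)) * ennreal (G \<omega> * y \<omega>)" for \<omega>
      using G y0 \<open>0 < x\<close> by (subst ennreal_mult[symmetric]) (simp_all add: ennreal_plus)
    then show ?thesis by (simp only:) (subst nn_integral_add; simp add: nn_integral_cmult)
  qed
  also have "\<dots> \<le> ?b" by (intro nn_integral_mono ennreal_leI pt)
  finally have main: "?a + ennreal (1 / (2 * x)) * (ennreal m * ?b) \<le> ?b" .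
  (* The integrals are finite, so the inequality can be rearranged in the reals. *)
  have fin: "?b < top" using b1 by (rule le_less_trans) simp
  obtain B where B: "?b = ennreal B" "0 \<le> B" using fin by (cases ?b) auto
  have "?a \<le> ?b" using main by (rule order_trans[rotated]) simp
  then have "?a < top" using fin by (rule le_less_trans)
  then obtain A where A: "?a = ennreal A" "0 \<le> A" by (cases ?a) auto
  have "ennreal (A + 1 / (2 * x) * (m * B)) \<le> ennreal B"
  proof -
    have "ennreal (A + 1 / (2 * x) * (m * B)) = ennreal A + ennreal (1 / (2 * x) * (m * B))"
      using A B \<open>0 < x\<close> \<open>0 \<le> m\<close> by (intro ennreal_plus) auto
    also have "ennreal (1 / (2 * x) * (m * B)) = ennreal (1 / (2 * x)) * (ennreal m * ennreal B)"
      using B \<open>0 < x\<close> \<open>0 \<le> m\<close> by (simp flip: ennreal_mult)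
    finally show ?thesis using main unfolding A(1) B(1) by simp
  qed
  then have "A \<le> (1 - m / (2 * x)) * B" using B by (simp add: algebra_simps)
  also have "\<dots> \<le> exp (- (m / (2 * x))) * B"
    using exp_ge_add_one_self[of "- (m / (2 * x))"] B by (intro mult_right_mono) auto
  finally show ?thesis using A B by (simp add: ennreal_leI flip: ennreal_mult)
qed

lemma nn_integral_exp_minus_sum_le:
  fixes d :: "nat \<Rightarrow> 'a \<Rightarrow> real"
  assumes "prob_space M" and sub: "\<And>t. subalgebra M (F t)"
    and ad: "\<And>s t. s < t \<Longrightarrow> d s \<in> borel_measurable (F t)" and d0: "\<And>t \<omega>. 0 \<le> d t \<omega>"
    and "0 < x" "0 \<le> m"
    and low: "\<And>t. AE \<omega> in M. nn_cond_exp M (F t)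
        (\<lambda>\<omega>. ennreal (d t \<omega> * indicator {\<omega>. d t \<omega> \<le> x} \<omega>)) \<omega> \<ge> ennreal m"
  shows "(\<integral>\<^sup>+ \<omega>. ennreal (exp (- ((\<Sum>s<t. d s \<omega>) / x))) \<partial>M) \<le> ennreal (exp (- (real t * (m / (2 * x)))))"
proof (induction t)
  case 0
  interpret prob_space M by fact
  show ?case by (simp add: emeasure_space_1)
next
  case (Suc t)
  let ?G = "\<lambda>\<omega>. exp (- ((\<Sum>s<t. d s \<omega>) / x))"
  have [measurable]: "s < t \<Longrightarrow> d s \<in> borel_measurable (F t)" for s by (rule ad)
  have "(\<integral>\<^sup>+ \<omega>. ennreal (exp (- ((\<Sum>s<Suc t. d s \<omega>) / x))) \<partial>M)
      = (\<integral>\<^sup>+ \<omega>. ennreal (?G \<omega> * exp (- d t \<omega> / x)) \<partial>M)"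
    by (simp add: add_divide_distrib exp_add[symmetric] diff_divide_distrib)
  also have "\<dots> \<le> ennreal (exp (- (m / (2 * x)))) * (\<integral>\<^sup>+ \<omega>. ennreal (?G \<omega>) \<partial>M)"
  proof (rule nn_integral_exp_minus_step[OF assms(1) sub[of t] _ _ _ _ d0 \<open>0 < x\<close> \<open>0 \<le> m\<close> low])
    show "?G \<in> borel_measurable (F t)" by measurable
    show "d t \<in> borel_measurable M"
      by (rule measurable_from_subalg[OF sub ad[of t "Suc t"]]) simp
    show "?G \<omega> \<le> 1" for \<omega> using d0 \<open>0 < x\<close> by (simp add: sum_nonneg)
  qed simp
  also have "\<dots> \<le> ennreal (exp (- (m / (2 * x)))) * ennreal (exp (- (real t * (m / (2 * x)))))"
    by (intro mult_left_mono Suc.IH) simp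
  also have "\<dots> = ennreal (exp (- (real (Suc t) * (m / (2 * x)))))"
    by (simp add: algebra_simps flip: ennreal_mult exp_add)
      (simp add: add_divide_distrib)
  finally show ?case .
qed

text \<open>
  Integrating the conditional bound gives a bound on \<open>\<beta>\<close>-th moments that is uniform in time.
  It passes to exponents \<open>b \<le> \<beta>\<close> through \<open>u powr b \<le> 1 + u powr \<beta>\<close>, and the weights with
  \<open>p > 1\<close> make the expectations summable.
\<close>

lemma AE_summable_weighted_powr_of_cond_moment:
  fixes n :: "nat \<Rightarrow> 'a \<Rightarrow> real"
  assumes "prob_space M" and sub: "\<And>t. subalgebra M (F t)"
    and [measurable]: "\<And>t. n t \<in> borel_measurable M" and n0: "\<And>t \<omega>. 0 \<le> n t \<omega>"
    and "0 < b" "b \<le> \<beta>" "1 < p"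
    and up: "\<And>t. AE \<omega> in M. nn_cond_exp M (F t) (\<lambda>\<omega>. ennreal (n t \<omega> powr \<beta>)) \<omega> \<le> ennreal C"
  shows "AE \<omega> in M. summable (\<lambda>t. n t \<omega> powr b / real (Suc t) powr p)"
proof (rule AE_summable_of_nn_integral_le_summable)
  interpret prob_space M by fact
  let ?K = "1 + max C 0"
  fix t
  interpret finite_measure_subalgebra M "F t" by unfold_locales (rule sub)
  let ?v = "real (Suc t) powr p"
  have "(\<integral>\<^sup>+ \<omega>. ennreal (n t \<omega> powr \<beta>) \<partial>M)
      = (\<integral>\<^sup>+ \<omega>. nn_cond_exp M (F t) (\<lambda>\<omega>. ennreal (n t \<omega> powr \<beta>)) \<omega> \<partial>M)"
    using nn_cond_exp_intg[of "\<lambda>_. 1" "\<lambda>\<omega>. ennreal (n t \<omega> powr \<beta>)"] by simp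
  also have "\<dots> \<le> (\<integral>\<^sup>+ \<omega>. ennreal C \<partial>M)" using up by (rule nn_integral_mono_AE)
  also have "\<dots> = ennreal (max C 0)" by (simp add: emeasure_space_1 max_def ennreal_neg)
  finally have mom: "(\<integral>\<^sup>+ \<omega>. ennreal (n t \<omega> powr \<beta>) \<partial>M) \<le> ennreal (max C 0)" .
  have "(\<integral>\<^sup>+ \<omega>. ennreal (n t \<omega> powr b / ?v) \<partial>M)
      \<le> (\<integral>\<^sup>+ \<omega>. ennreal (1 / ?v) * (1 + ennreal (n t \<omega> powr \<beta>)) \<partial>M)"
  proof (rule nn_integral_mono)
    fix \<omega>
    have "n t \<omega> powr b / ?v \<le> 1 / ?v * (1 + n t \<omega> powr \<beta>)"
      using powr_le_one_plus_powr[of "n t \<omega>" b \<beta>] n0 assms by (simp add: divide_right_mono)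
    then have "ennreal (n t \<omega> powr b / ?v) \<le> ennreal (1 / ?v * (1 + n t \<omega> powr \<beta>))"
      by (rule ennreal_leI)
    then show "ennreal (n t \<omega> powr b / ?v) \<le> ennreal (1 / ?v) * (1 + ennreal (n t \<omega> powr \<beta>))"
      by (simp only: ennreal_mult' ennreal_plus ennreal_1 powr_ge_zero zero_le_one
          zero_le_divide_1_iff)
  qed
  also have "\<dots> = ennreal (1 / ?v) * (1 + (\<integral>\<^sup>+ \<omega>. ennreal (n t \<omega> powr \<beta>) \<partial>M))"
    by (simp add: nn_integral_cmult nn_integral_add emeasure_space_1)
  also have "\<dots> \<le> ennreal (1 / ?v) * (1 + ennreal (max C 0))"
    by (intro mult_left_mono add_left_mono mom) simp
  also have "\<dots> = ennreal (?K * real (Suc t) powr (- p))"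
  proof -
    have "1 + ennreal (max C 0) = ennreal (1 + max C 0)"
      by (subst ennreal_plus) (auto simp: ennreal_1)
    then show ?thesis
      by (simp only:) (subst ennreal_mult[symmetric], auto simp: powr_minus field_simps)
  qed
  finally show "(\<integral>\<^sup>+ \<omega>. ennreal (n t \<omega> powr b / ?v) \<partial>M)
      \<le> ennreal (?K * real (Suc t) powr (- p))" .
next
  have "summable (\<lambda>t. real t powr (- p))" using \<open>1 < p\<close> by (simp add: summable_real_powr_iff)
  then have "summable (\<lambda>t. real (Suc t) powr (- p))" by (subst summable_Suc_iff)
  then show "summable (\<lambda>t. (1 + max C 0) * real (Suc t) powr (- p))" by (rule summable_mult)
qed auto

section \<open>Transience\<close>

theorem theorem2p1:
  fixes M :: "'a measure" and F :: "nat \<Rightarrow> 'a measure" and X :: "nat \<Rightarrow> 'a \<Rightarrow> real"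
    and \<alpha> \<beta> C c x\<^sub>0 :: real
  assumes "prob_space M"
    and "adapted_process M F X"
    and "AE \<omega> in M. X 0 \<omega> = 0"
    and "0 < \<alpha>" and "\<alpha> < 1" and "\<alpha> < \<beta>"
    and "0 < c" and "0 < x\<^sub>0"
    and "\<And>t. AE \<omega> in M.
           nn_cond_exp M (F t) (\<lambda>\<omega>. ennreal (neg_part (increment X t \<omega>) powr \<beta>)) \<omega> \<le> ennreal C"
    and "\<And>x t. x \<ge> x\<^sub>0 \<Longrightarrow> AE \<omega> in M.
           nn_cond_exp M (F t)
             (\<lambda>\<omega>. ennreal (pos_part (increment X t \<omega>) *
                indicator {\<omega>. pos_part (increment X t \<omega>) \<le> x} \<omega>)) \<omega>
           \<ge> ennreal (c * x powr (1 - \<alpha>))"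
  shows "AE \<omega> in M. filterlim (\<lambda>t. X t \<omega>) at_top sequentially"
proof -
  let ?p = "\<lambda>t \<omega>. pos_part (increment X t \<omega>)"
  let ?n = "\<lambda>t \<omega>. neg_part (increment X t \<omega>)"
  have filt: "filtration (space M) F" and sub: "\<And>t. subalgebra M (F t)"
    and ad: "\<And>t. X t \<in> borel_measurable (F t)"
    using assms(2) by (auto simp: adapted_process_def)
  have Xm: "X s \<in> borel_measurable (F t)" if "s \<le> t" for s t
  proof -
    have "sets (F s) \<subseteq> sets (F t)" "space (F s) = space (F t)"
      using filt that by (auto simp: filtration_def)
    then show ?thesis using ad[of s] by (auto simp: measurable_def)
  qed
  have part_meas: "pos_part \<in> borel_measurable borel" "neg_part \<in> borel_measurable borel"
    unfolding pos_part_def[abs_def] neg_part_def[abs_def] by measurable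
  have incr: "increment X s \<in> borel_measurable (F t)" if "s < t" for s t
    using Xm[of s t] Xm[of "Suc s" t] that unfolding increment_def[abs_def] by simp
  have pm: "?p s \<in> borel_measurable (F t)" if "s < t" for s t
    using measurable_compose[OF incr[OF that] part_meas(1)] .
  have pM [measurable]: "?p s \<in> borel_measurable M" for s
    by (rule measurable_from_subalg[OF sub pm]) (rule lessI)
  have nM: "?n s \<in> borel_measurable M" for s
    using measurable_compose[OF measurable_from_subalg[OF sub incr[OF lessI]] part_meas(2)] .
  have p0: "0 \<le> ?p s \<omega>" and n0: "0 \<le> ?n s \<omega>" for s \<omega>
    by (auto simp: pos_part_def neg_part_def indicator_def)

  define b where "b = min \<beta> 1"
  have b: "0 < b" "b \<le> 1" "b \<le> \<beta>" "\<alpha> < b" using assms by (auto simp: b_def)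
  have "1 / b < 1 / \<alpha>" using b assms by (simp add: frac_less2)
  then obtain q where q: "1 / b < q" "q < 1 / \<alpha>" using dense by blast
  have qb: "1 < q * b" and qa: "q * \<alpha> < 1" using q b assms by (simp_all add: field_simps)
  have q0: "0 < q" using q b by (meson divide_pos_pos less_trans zero_less_one)

  have neg: "AE \<omega> in M. summable (\<lambda>t. ?n t \<omega> powr b / real (Suc t) powr (q * b))"
    by (rule AE_summable_weighted_powr_of_cond_moment
        [OF assms(1) sub nM n0 b(1) b(3) qb assms(9)])

  (* The hypothesis on truncated means holds only for levels above x0, so the comparison
     starts at a time k from which the level t powr q is that large. *)
  have "eventually (\<lambda>t. x\<^sub>0 \<le> real t powr q \<and> 0 < t) sequentially"
  proof (intro eventually_conj eventually_gt_at_top)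
    show "eventually (\<lambda>t. x\<^sub>0 \<le> real t powr q) sequentially"
      using q0 by real_asymp
  qed
  then obtain k where k: "\<And>t. k \<le> t \<Longrightarrow> x\<^sub>0 \<le> real t powr q \<and> 0 < t"
    unfolding eventually_sequentially by blast
  have pos: "AE \<omega> in M. summable (\<lambda>t. exp (- ((\<Sum>s<t + k. ?p s \<omega>) / real (t + k) powr q)))"
  proof (rule AE_summable_of_nn_integral_le_summable)
    show "summable (\<lambda>t. exp (- (c / 2 * real (t + k) powr (1 - q * \<alpha>))))"
      using summable_ignore_initial_segment[OF summable_exp_minus_powr[of "c / 2" "1 - q * \<alpha>"], of k]
        qa \<open>0 < c\<close> by simp
    fix t
    let ?T = "real (t + k)" let ?x = "?T powr q"
    have T: "0 < ?T" and x: "x\<^sub>0 \<le> ?x" "0 < ?x" using k[of "t + k"] by auto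
    have "(\<integral>\<^sup>+ \<omega>. ennreal (exp (- ((\<Sum>s<t + k. ?p s \<omega>) / ?x))) \<partial>M)
        \<le> ennreal (exp (- (?T * (c * ?x powr (1 - \<alpha>) / (2 * ?x)))))"
      using x \<open>0 < c\<close>
      by (intro nn_integral_exp_minus_sum_le[OF assms(1) sub pm p0 x(2) _ assms(10)]) auto
    also have "?T * (c * ?x powr (1 - \<alpha>) / (2 * ?x)) = c / 2 * (?T * (?x powr (1 - \<alpha>) / ?x))"
      by simp
    also have "?T * (?x powr (1 - \<alpha>) / ?x) = ?T powr (1 - q * \<alpha>)"
    proof -
      have "?x powr (1 - \<alpha>) / ?x = ?T powr (- (q * \<alpha>))"
        using x by (simp add: powr_powr algebra_simps flip: powr_diff)
      then show ?thesis using T powr_add[of ?T 1 "- (q * \<alpha>)"] by simp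
    qed
    finally show "(\<integral>\<^sup>+ \<omega>. ennreal (exp (- ((\<Sum>s<t + k. ?p s \<omega>) / ?x))) \<partial>M)
        \<le> ennreal (exp (- (c / 2 * ?T powr (1 - q * \<alpha>))))" .
  qed auto

  show ?thesis using assms(3) neg pos
  proof eventually_elim
    case (elim \<omega>)
    obtain W where W: "\<And>t. (\<Sum>s<t. ?n s \<omega>) \<le> W * real t powr q"
      using sum_le_powr_if_summable_weighted_powr[OF n0 b(1,2) q0 elim(2)] by blast
    have "X t \<omega> = (\<Sum>s<t. ?p s \<omega>) - (\<Sum>s<t. ?n s \<omega>)" for t
    proof (induction t)
      case (Suc t)
      have "?p t \<omega> - ?n t \<omega> = X (Suc t) \<omega> - X t \<omega>"
        by (auto simp: pos_part_def neg_part_def increment_def indicator_def)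
      then show ?case using Suc by simp
    qed (use elim in simp)
    then show ?case
      using difference_of_sums_tendsto_infinity[OF q0 W elim(3)] by simp
  qed
qed

end
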